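(* (1) For every integer $k \geq 1$, there exist infinitely many infinite sets $S$ of positive integers such that, for the subtraction game with subtraction set $S$, the outcome sequence $(o(u))_{u \in \mathbb{N}}$ and the nim-sequence $(\mathcal{G}(u))_{u \in \mathbb{N}}$ are both (ultimately) periodic, and the period of the nim-sequence is exactly $k$ times the period of the outcome sequence. (2) There exist infinitely many infinite sets $S$ of positive integers such that, for the subtraction game with subtraction set $S$, the outcome sequence $(o(u))_{u \in \mathbb{N}}$ is (ultimately) periodic but the nim-sequence $(\mathcal{G}(u))_{u \in \mathbb{N}}$ is not (ultimately) periodic.
   Context: $\mathbb{N}$ denotes the nonnegative integers (including $0$). Given a nonempty set $S$ of positive integers (the subtraction set), the subtraction game with subtraction set $S$ is the impartial game whose positions are the natural numbers $u \in \mathbb{N}$ (a heap of $u$ tokens); a move removes $s$ tokens from the heap for some $s \in S$ with $s \leq u$, so the set of successors of $u$ is $\operatorname{next}(u) = \{u - s : s \in S,\ u - s \geq 0\}$. Two players alternate, and a player unable to move loses. An infinite subtraction game is one whose subtraction set $S$ is infinite; distinct games correspond to distinct subtraction sets. The outcome $o(u) \in \{\mathcal{P}, \mathcal{N}\}$ is defined recursively: $o(u) = \mathcal{N}$ if some $u' \in \operatorname{next}(u)$ has $o(u') = \mathcal{P}$, and $o(u) = \mathcal{P}$ otherwise. The SG value (nim value) is defined recursively by $\mathcal{G}(u) = \operatorname{mex}(\{\mathcal{G}(u') : u' \in \operatorname{next}(u)\})$, where $\operatorname{mex}(N) = \min(\mathbb{N} \setminus N)$; the nim-sequence is $(\mathcal{G}(u))_{u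 \in \mathbb{N}}$. Periodic means ultimately periodic: a sequence $(a(n))_{n \in \mathbb{N}}$ is periodic if there exist a preperiod $p \in \mathbb{N}$ and a period $t \geq 1$ such that $a(i+t) = a(i)$ for all $i \geq p$. The period of such a sequence is the minimal such $t \geq 1$. *)

theory Defs
  imports Main
begin

definition subtraction_set :: "nat set \<Rightarrow> bool" where
  "subtraction_set S \<longleftrightarrow> S \<noteq> {} \<and> (\<forall>s\<in>S. 0 < s)"

text \<open>
  The guard \<open>0 < s\<close> is redundant for a subtraction set; it makes the recursive functions below
  terminate for an arbitrary argument \<open>S\<close>.
\<close>

definition successors :: "nat set \<Rightarrow> nat \<Rightarrow> nat set" where
  "successors S u = {u - s | s. s \<in> S \<and> 0 < s \<and> s \<le> u}"

lemma successors_less: "v \<in> successors S u \<Longrightarrow> v < u"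
  by (auto simp: successors_def)

datatype outcome = P_position | N_position

function outcome_of :: "nat set \<Rightarrow> nat \<Rightarrow> outcome" where
  "outcome_of S u =
    (if \<exists>v\<in>successors S u. outcome_of S v = P_position then N_position else P_position)"
  by pat_completeness auto
termination
  by (relation "measure snd") (auto dest: successors_less)

declare outcome_of.simps [simp del]

definition mex :: "nat set \<Rightarrow> nat" where
  "mex A = (LEAST n. n \<notin> A)"

function sg_value :: "nat set \<Rightarrow> nat \<Rightarrow> nat" where
  "sg_value S u = mex ((\<lambda>v. sg_value S v) ` successors S u)"
  by pat_completeness auto
termination
  by (relation "measure snd") (auto dest: successors_less)

declare sg_value.simps [simp del]

definition eventual_period :: "(nat \<Rightarrow> 'a) \<Rightarrow> nat \<Rightarrow> bool" where
  "eventual_period a t \<longleftrightarrow> 1 \<le> t \<and> (\<exists>p. \<forall>i\<ge>p. a (i + t) = a i)"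

definition eventually_periodic :: "(nat \<Rightarrow> 'a) \<Rightarrow> bool" where
  "eventually_periodic a \<longleftrightarrow> (\<exists>t. eventual_period a t)"

text \<open>The least eventual period; only meaningful for eventually periodic sequences.\<close>

definition least_period :: "(nat \<Rightarrow> 'a) \<Rightarrow> nat" where
  "least_period a = (LEAST t. eventual_period a t)"

end

theory Submission
  imports Defs
begin

text \<open>
  The subtraction game on \<open>{1, 4, 5, 10, 11, 14}\<close> has a nim-sequence of period 15 (the list
  \<open>base_values\<close>), and each nim-value is realised by moves inside a block of 15 positions.
  Its largest value 5 occurs at the residues 11 and 14 only, and a difference of \<open>\<plusminus>3\<close> modulo 15
  separates equal values only at this pair of residues. Hence all moves \<open>15 i \<plusminus> 3\<close> can be added
  without touching the values below 5, and they make the two residues replay, on the block numbers,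
  the game whose moves are the \<open>i\<close>. If these are the non-multiples of \<open>k\<close>, the block \<open>m\<close> gets the
  value \<open>5 + m mod k\<close>, so the period is multiplied by \<open>k\<close> while the zeros stay in place. For
  \<open>k = 0\<close> every \<open>i > 0\<close> is allowed, the value is \<open>5 + m\<close>, and periodicity is lost.
  Moves congruent to 1 modulo 15 can be added freely, which yields infinitely many games.
\<close>

section \<open>SG values, outcomes and periods in general\<close>

lemma mex_eqI: "n \<notin> A \<Longrightarrow> (\<And>j. j < n \<Longrightarrow> j \<in> A) \<Longrightarrow> mex A = n"
  unfolding mex_def by (rule Least_equality) (auto simp: not_less[symmetric])

text \<open>The first condition keeps \<open>f u\<close> out of the set of successor values and the
  second puts every smaller number into it, so \<open>f u\<close> is the mex. This replaces the
  recursion by two local checks on a guessed function.\<close>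

lemma sg_value_eqI:
  assumes ne: "\<And>u v. v \<in> successors S u \<Longrightarrow> f v \<noteq> f u"
    and reach: "\<And>u j. j < f u \<Longrightarrow> \<exists>v\<in>successors S u. f v = j"
  shows "sg_value S u = f u"
proof (induction u rule: less_induct)
  case (less u)
  have "(\<lambda>v. sg_value S v) ` successors S u = f ` successors S u"
    using less successors_less by (intro image_cong) auto
  moreover have "mex (f ` successors S u) = f u"
  proof (rule mex_eqI)
    show "f u \<notin> f ` successors S u"
      using ne by fastforce
    show "j \<in> f ` successors S u" if "j < f u" for j
      using reach[OF that] by blast
  qed
  ultimately show ?case
    by (simp add: sg_value.simps[of S u])
qed

text \<open>Finiteness ensures that some number lies outside \<open>A\<close>, so that the
  \<open>LEAST\<close> in \<open>mex\<close> is attained.\<close>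

lemma mex_eq_0_iff:
  assumes "finite A"
  shows "mex A = 0 \<longleftrightarrow> 0 \<notin> A"
proof
  have "\<exists>n. n \<notin> A"
    using assms ex_new_if_finite infinite_UNIV_nat by blast
  then have "mex A \<notin> A"
    unfolding mex_def by (rule LeastI_ex)
  then show "mex A = 0 \<Longrightarrow> 0 \<notin> A"
    by simp
qed (auto intro: mex_eqI)

lemma finite_successors: "finite (successors S u)"
  by (rule finite_subset[of _ "{..<u}"]) (auto dest: successors_less)

text \<open>Outcomes only record where the SG value vanishes, so the outcome sequence can be studied
  through the zeros of an explicit SG function.\<close>

lemma outcome_of_eq_P_iff: "outcome_of S u = P_position \<longleftrightarrow> sg_value S u = 0"
proof (induction u rule: less_induct)
  case (less u)
  have "outcome_of S u = P_position \<longleftrightarrow> (\<forall>v\<in>successors S u. outcome_of S v \<noteq> P_position)"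
    by (subst outcome_of.simps) auto
  also have "\<dots> \<longleftrightarrow> 0 \<notin> (\<lambda>v. sg_value S v) ` successors S u"
    using less successors_less by fastforce
  also have "\<dots> \<longleftrightarrow> sg_value S u = 0"
    by (subst sg_value.simps) (simp only: mex_eq_0_iff[OF finite_imageI[OF finite_successors]])
  finally show ?case .
qed

lemma outcome_of_eq_iff:
  "outcome_of S u = outcome_of S v \<longleftrightarrow> (sg_value S u = 0 \<longleftrightarrow> sg_value S v = 0)"
  unfolding outcome_of_eq_P_iff[symmetric]
  by (cases "outcome_of S u"; cases "outcome_of S v") auto

text \<open>The form in which both sequences are analysed: the eventual periods are the positive
  multiples of one number \<open>p\<close>. With \<open>p = 0\<close> the same description would say
  that there are none.\<close>

lemma least_period_eqI:
  assumes "\<And>t. eventual_period a t \<longleftrightarrow> 1 \<le> t \<and> p dvd t" and "1 \<le> p"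
  shows "least_period a = p"
  unfolding least_period_def
  by (rule Least_equality) (use assms in \<open>auto intro: dvd_imp_le\<close>)

section \<open>The base game and its extensions\<close>

definition base_values :: "nat list" where
  "base_values = [0, 1, 0, 1, 2, 3, 2, 3, 0, 1, 4, 5, 2, 3, 5]"

text \<open>Since \<open>x mod 0 = x\<close>, the case \<open>k = 0\<close> gives the unbounded
  values \<open>5 + u div 15\<close>.\<close>

definition nim_colour :: "nat \<Rightarrow> nat \<Rightarrow> nat" where
  "nim_colour k u =
    (let b = base_values ! (u mod 15) in if b = 5 then 5 + u div 15 mod k else b)"

definition base_moves :: "nat set" where
  "base_moves = {1, 4, 5, 10, 11, 14}"

text \<open>The condition \<open>\<not> k dvd i\<close> excludes \<open>i = 0\<close>, so
  \<open>15 * i - 3\<close> is never truncated; for \<open>k = 0\<close> it excludes nothing else.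
  The moves \<open>15 * i + 1\<close> keep the set infinite even for \<open>k = 1\<close>, where no
  other moves are added, and \<open>n\<close> serves to vary the set.\<close>

definition moves :: "nat \<Rightarrow> nat \<Rightarrow> nat set" where
  "moves n k = base_moves \<union> {15 * i + 1 | i. n < i}
    \<union> {15 * i + 3 | i. \<not> k dvd i} \<union> {15 * i - 3 | i. \<not> k dvd i}"

lemma less_15_iff:
  "r < 15 \<longleftrightarrow> r \<in> {0, 1, 2, 3, 4, 5, 6, 7, 8, 9, 10, 11, 12, 13, 14 :: nat}"
  by (auto simp: less_Suc_eq numeral_eq_Suc)

lemma base_values_le: "r < 15 \<Longrightarrow> base_values ! r \<le> 5"
  unfolding less_15_iff base_values_def by auto

lemma base_values_eq_5_iff: "r < 15 \<Longrightarrow> base_values ! r = 5 \<longleftrightarrow> r = 11 \<or> r = 14"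
  unfolding less_15_iff base_values_def by auto

text \<open>The inequality holds cyclically, so it also covers moves across block boundaries and all
  moves congruent to a base move.\<close>

lemma base_values_base_move:
  "r < 15 \<Longrightarrow> d \<in> base_moves \<Longrightarrow> base_values ! ((r + d) mod 15) \<noteq> base_values ! r"
  unfolding less_15_iff base_values_def base_moves_def by auto

lemma base_values_add_3:
  "r < 15 \<Longrightarrow> base_values ! ((r + 3) mod 15) = base_values ! r \<Longrightarrow> r = 11"
  unfolding less_15_iff base_values_def by auto

text \<open>Adding 12 is subtracting 3 modulo 15; this is the case of the moves
  \<open>15 * i - 3\<close>.\<close>

lemma base_values_add_12:
  "r < 15 \<Longrightarrow> base_values ! ((r + 12) mod 15) = base_values ! r \<Longrightarrow> r = 14"
  unfolding less_15_iff base_values_def by auto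

lemma base_values_reach:
  "r < 15 \<Longrightarrow> j < base_values ! r \<Longrightarrow> \<exists>s\<in>base_moves. s \<le> r \<and> base_values ! (r - s) = j"
  unfolding less_15_iff base_values_def base_moves_def
  by (auto simp: less_Suc_eq numeral_eq_Suc)

section \<open>The SG values of the extended game\<close>

text \<open>Colours from 5 upwards all come from base value 5 and smaller colours equal their base
  value, so a colour determines its base value.\<close>

lemma nim_colour_ne:
  "base_values ! (u mod 15) \<noteq> base_values ! (v mod 15) \<Longrightarrow> nim_colour k u \<noteq> nim_colour k v"
  using base_values_le[of "u mod 15"] base_values_le[of "v mod 15"]
  by (auto simp: nim_colour_def Let_def)

lemma nim_colour_block:
  "nim_colour k (15 * m + 11) = 5 + m mod k" "nim_colour k (15 * m + 14) = 5 + m mod k"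
  by (auto simp: nim_colour_def base_values_def)

lemma dvd_of_add_mod_eq: "(m + i) mod k = m mod k \<Longrightarrow> k dvd i" for m i k :: nat
  using mod_eq_dvd_iff_nat[of m "m + i" k] by simp

lemma moves_pos:
  assumes "s \<in> moves n k"
  shows "0 < s"
proof -
  have "0 < 15 * i - 3" if "\<not> k dvd i" for i
    using that by (cases i) auto
  then show ?thesis
    using assms unfolding moves_def base_moves_def by auto
qed

lemma nim_colour_move_ne:
  assumes "s \<in> moves n k"
  shows "nim_colour k (v + s) \<noteq> nim_colour k v"
proof -
  define r where "r = v mod 15"
  define m where "m = v div 15"
  have r: "r < 15" and v: "v = 15 * m + r"
    by (simp_all add: r_def m_def)
  \<comment> \<open>Only the residue of the move matters here, which handles the base moves and the
    moves \<open>15 * i + 1\<close> together.\<close>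
  have base: ?thesis if d: "d \<in> base_moves" "s mod 15 = d mod 15" for d
  proof -
    have "(v + s) mod 15 = (r + d) mod 15"
      unfolding r_def using d(2) by (metis mod_add_eq mod_mod_trivial)
    then show ?thesis
      using base_values_base_move[OF r d(1)] by (intro nim_colour_ne) (simp add: r_def)
  qed
  consider "s \<in> base_moves" | i where "s = 15 * i + 1"
    | i where "s = 15 * i + 3" "\<not> k dvd i"
    | i where "s = 15 * i - 3" "\<not> k dvd i"
    using assms unfolding moves_def by blast
  then show ?thesis
  proof cases
    case 1
    then show ?thesis
      by (rule base) simp
  next
    case (2 i)
    have "1 \<in> base_moves" "s mod 15 = 1 mod 15"
      unfolding 2 base_moves_def by simp_all
    then show ?thesis
      by (rule base)
  next
    case (3 i)
    have "v + s = (r + 3) + 15 * (m + i)"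
      using v 3 by simp
    then have mod: "(v + s) mod 15 = (r + 3) mod 15"
      by (simp only: mod_mult_self2)
    \<comment> \<open>Only from residue 11 to residue 14 do the base values agree; there the block
      numbers differ by \<open>i\<close>, which \<open>k\<close> does not divide.\<close>
    show ?thesis
    proof (cases "r = 11")
      case True
      then have "v = 15 * m + 11" "v + s = 15 * (m + i) + 14"
        using v 3 by (simp_all add: algebra_simps)
      then have "nim_colour k v = 5 + m mod k" "nim_colour k (v + s) = 5 + (m + i) mod k"
        by (simp_all only: nim_colour_block)
      then show ?thesis
        using 3(2) dvd_of_add_mod_eq[of m i k] by auto
    next
      case False
      then show ?thesis
        using base_values_add_3[OF r] mod by (intro nim_colour_ne) (auto simp: r_def)
    qed
  next
    case (4 i)
    then have i: "1 \<le> i"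
      by (cases i) auto
    \<comment> \<open>The offset -3 is written as +12 with one block fewer, to stay within the
      naturals.\<close>
    have "v + s = (r + 12) + 15 * (m + (i - 1))"
      using v 4 i by (cases i) simp_all
    then have mod: "(v + s) mod 15 = (r + 12) mod 15"
      by (simp only: mod_mult_self2)
    show ?thesis
    proof (cases "r = 14")
      case True
      then have "v = 15 * m + 14" "v + s = 15 * (m + i) + 11"
        using v 4 i by (simp_all add: algebra_simps)
      then have "nim_colour k v = 5 + m mod k" "nim_colour k (v + s) = 5 + (m + i) mod k"
        by (simp_all only: nim_colour_block)
      then show ?thesis
        using 4(2) dvd_of_add_mod_eq[of m i k] by auto
    next
      case False
      then show ?thesis
        using base_values_add_12[OF r] mod by (intro nim_colour_ne) (auto simp: r_def)
    qed
  qed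
qed

text \<open>Going back \<open>m mod k - j\<close> blocks works: this number is positive and, for
  \<open>k > 0\<close>, smaller than \<open>k\<close>, hence no multiple of \<open>k\<close>. For
  \<open>k = 0\<close> it is \<open>m - j > 0\<close>, no multiple of 0.\<close>

lemma smaller_residue_reachable:
  fixes m k j :: nat
  assumes "j < m mod k"
  obtains i where "\<not> k dvd i" "1 \<le> i" "i \<le> m" "(m - i) mod k = j"
proof
  define i where "i = m mod k - j"
  have le: "m mod k \<le> m"
    by (rule mod_less_eq_dividend)
  have m: "m = k * (m div k) + m mod k"
    by simp
  have less: "m mod k < k" if "k \<noteq> 0"
    using that by simp
  show "1 \<le> i" "i \<le> m"
    using assms le unfolding i_def by linarith+
  show "\<not> k dvd i"
  proof
    assume "k dvd i"
    then have "k \<le> i" and "k \<noteq> 0"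
      using \<open>1 \<le> i\<close> dvd_imp_le[of k i] by auto
    then show False
      using less unfolding i_def by linarith
  qed
  have "m - i = k * (m div k) + j"
    using assms m unfolding i_def by linarith
  then show "(m - i) mod k = j"
    using assms less less_trans[of j "m mod k" k] by (cases "k = 0") auto
qed

lemma nim_colour_reach:
  assumes "j < nim_colour k u"
  shows "\<exists>v\<in>successors (moves n k) u. nim_colour k v = j"
proof -
  define r where "r = u mod 15"
  define m where "m = u div 15"
  have r: "r < 15" and u: "u = 15 * m + r"
    by (simp_all add: r_def m_def)
  have succ: "v \<in> successors (moves n k) u" if "s \<in> moves n k" "u = v + s" for s v
  proof -
    have "v = u - s" "s \<le> u" "0 < s"
      using that moves_pos by simp_all
    then show ?thesis
      unfolding successors_def using that(1) by blast
  qed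
  show ?thesis
  \<comment> \<open>Colours below the base value are reached by base moves inside the block; the
    remaining ones arise only at residues 11 and 14 and need a move to an earlier block.\<close>
  proof (cases "j < base_values ! r")
    case True
    then obtain s where s: "s \<in> base_moves" "s \<le> r" "base_values ! (r - s) = j"
      using base_values_reach r by blast
    have "(15 * m + (r - s)) mod 15 = r - s"
      using r by (simp only: mod_mult_self4 mod_less less_imp_diff_less)
    then have "base_values ! ((15 * m + (r - s)) mod 15) = j"
      using s by simp
    moreover have "j \<noteq> 5"
      using True base_values_le[OF r] by simp
    ultimately have "nim_colour k (15 * m + (r - s)) = j"
      unfolding nim_colour_def Let_def by presburger
    moreover have "15 * m + (r - s) \<in> successors (moves n k) u"
      by (rule succ[of s]) (use s u in \<open>auto simp: moves_def\<close>)
    ultimately show ?thesis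
      by blast
  next
    case False
    then have five: "base_values ! r = 5"
      using assms unfolding nim_colour_def Let_def r_def by presburger
    then have "nim_colour k u = 5 + m mod k"
      by (simp add: nim_colour_def r_def m_def)
    then have "j - 5 < m mod k" and "5 \<le> j"
      using assms False five by auto
    then obtain i where i: "\<not> k dvd i" "1 \<le> i" "i \<le> m" "(m - i) mod k = j - 5"
      using smaller_residue_reachable by blast
    consider "r = 11" | "r = 14"
      using five base_values_eq_5_iff[OF r] by blast
    then show ?thesis
    \<comment> \<open>The move leads to the other of the two residues, \<open>i\<close> blocks
      earlier: 11 goes to 14 by \<open>15 * i - 3\<close>, and 14 goes to 11 by
      \<open>15 * i + 3\<close>.\<close>
    proof cases
      case 1
      have "15 * (m - i) + 14 \<in> successors (moves n k) u"
        by (rule succ[of "15 * i - 3"]) (use i u 1 in \<open>auto simp: moves_def\<close>)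
      then show ?thesis
        using i \<open>5 \<le> j\<close> by (intro bexI[of _ "15 * (m - i) + 14"]) (simp_all add: nim_colour_block)
    next
      case 2
      have "15 * (m - i) + 11 \<in> successors (moves n k) u"
        by (rule succ[of "15 * i + 3"]) (use i u 2 in \<open>auto simp: moves_def\<close>)
      then show ?thesis
        using i \<open>5 \<le> j\<close> by (intro bexI[of _ "15 * (m - i) + 11"]) (simp_all add: nim_colour_block)
    qed
  qed
qed

lemma sg_value_moves: "sg_value (moves n k) u = nim_colour k u"
proof (rule sg_value_eqI)
  show "nim_colour k v \<noteq> nim_colour k u" if v: "v \<in> successors (moves n k) u" for u v
  proof -
    obtain s where "s \<in> moves n k" "u = v + s"
      using v unfolding successors_def by auto
    then show ?thesis
      using nim_colour_move_ne[of s n k v] by simp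
  qed
qed (rule nim_colour_reach)

section \<open>The eventual periods of both sequences\<close>

lemma nim_colour_eq_0_iff: "nim_colour k u = 0 \<longleftrightarrow> u mod 15 \<in> {0, 2, 8}"
proof -
  have "u mod 15 < 15"
    by simp
  then show ?thesis
    unfolding less_15_iff nim_colour_def base_values_def by auto
qed

text \<open>The cyclic gaps 2, 6, 7 between the zeros are distinct, so no nontrivial rotation modulo
  15 preserves them.\<close>

lemma zeros_shift:
  assumes "t < 15" and "\<And>r. r < 15 \<Longrightarrow> (r + t) mod 15 \<in> {0, 2, 8 :: nat} \<longleftrightarrow> r \<in> {0, 2, 8}"
  shows "t = 0"
  using assms(1) assms(2)[of 0] assms(2)[of 2] assms(2)[of 8] unfolding less_15_iff by auto

lemma eventual_period_outcome_moves:
  "eventual_period (outcome_of (moves n k)) t \<longleftrightarrow> 1 \<le> t \<and> 15 dvd t"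
proof (intro iffI conjI)
  assume per: "eventual_period (outcome_of (moves n k)) t"
  then show "1 \<le> t"
    by (simp add: eventual_period_def)
  obtain p where p: "\<And>i. p \<le> i \<Longrightarrow> outcome_of (moves n k) (i + t) = outcome_of (moves n k) i"
    using per unfolding eventual_period_def by blast
  have "t mod 15 = 0"
  proof (rule zeros_shift)
    fix r :: nat assume "r < 15"
    \<comment> \<open>The position \<open>15 * p + r\<close> has residue \<open>r\<close> and lies
      beyond the preperiod \<open>p\<close>.\<close>
    have "(15 * p + r + t) mod 15 \<in> {0, 2, 8} \<longleftrightarrow> (15 * p + r) mod 15 \<in> {0, 2, 8}"
    proof -
      have "p \<le> 15 * p + r"
        by simp
      then show ?thesis
        using p[of "15 * p + r"]
        unfolding outcome_of_eq_iff sg_value_moves nim_colour_eq_0_iff by (simp only:)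
    qed
    moreover have "(15 * p + r) mod 15 = r" "(15 * p + r + t) mod 15 = (r + t mod 15) mod 15"
      using \<open>r < 15\<close> by (simp_all add: add.assoc mod_simps)
    ultimately show "(r + t mod 15) mod 15 \<in> {0, 2, 8} \<longleftrightarrow> r \<in> {0, 2, 8}"
      by (simp only:)
  qed simp
  then show "15 dvd t"
    by (rule iffD2[OF dvd_eq_mod_eq_0])
next
  assume t: "1 \<le> t \<and> 15 dvd t"
  then obtain j where "t = 15 * j"
    by auto
  then have "(i + t) mod 15 = i mod 15" for i
    by simp
  then show "eventual_period (outcome_of (moves n k)) t"
    using t unfolding eventual_period_def outcome_of_eq_iff sg_value_moves nim_colour_eq_0_iff
    by (simp only:) simp
qed

text \<open>For \<open>k = 0\<close> the right-hand side is unsatisfiable, which is how aperiodicity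
  is obtained.\<close>

lemma eventual_period_sg_moves:
  "eventual_period (sg_value (moves n k)) t \<longleftrightarrow> 1 \<le> t \<and> k * 15 dvd t"
proof (intro iffI conjI)
  assume per: "eventual_period (sg_value (moves n k)) t"
  then show "1 \<le> t"
    by (simp add: eventual_period_def)
  obtain p where p: "\<And>i. p \<le> i \<Longrightarrow> sg_value (moves n k) (i + t) = sg_value (moves n k) i"
    using per unfolding eventual_period_def by blast
  \<comment> \<open>A period of the SG values is a period of their zeros, so \<open>t\<close> is a
    whole number \<open>j\<close> of blocks. Residue 11, where the colour shows the block number
    modulo \<open>k\<close>, then forces \<open>k dvd j\<close>.\<close>
  have "eventual_period (outcome_of (moves n k)) t"
    unfolding eventual_period_def outcome_of_eq_iff
    using \<open>1 \<le> t\<close> p by (intro conjI exI[of _ p]) simp_all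
  then obtain j where j: "t = 15 * j"
    unfolding eventual_period_outcome_moves by auto
  have shift: "15 * p + 11 + t = 15 * (p + j) + 11"
    by (simp add: j)
  have "nim_colour k (15 * (p + j) + 11) = nim_colour k (15 * p + 11)"
    using p[of "15 * p + 11"] unfolding shift sg_value_moves by simp
  then have "(p + j) mod k = p mod k"
    by (simp only: nim_colour_block add_left_cancel)
  then have "k dvd j"
    by (rule dvd_of_add_mod_eq)
  then show "k * 15 dvd t"
    unfolding j by (subst mult.commute) (rule mult_dvd_mono, simp_all)
next
  assume t: "1 \<le> t \<and> k * 15 dvd t"
  then obtain j where j: "t = 15 * (k * j)"
    by auto
  have "(i + t) mod 15 = i mod 15" "(i + t) div 15 mod k = i div 15 mod k" for i
    by (simp_all add: j)
  then have "nim_colour k (i + t) = nim_colour k i" for i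
    unfolding nim_colour_def by (simp only:)
  then show "eventual_period (sg_value (moves n k)) t"
    using t unfolding eventual_period_def sg_value_moves by blast
qed

section \<open>Infinitely many infinite subtraction sets\<close>

lemma subtraction_set_moves: "subtraction_set (moves n k)"
  unfolding subtraction_set_def using moves_pos by (auto simp: moves_def base_moves_def)

text \<open>The moves congruent to 1 modulo 15 reveal \<open>n\<close>; the exception
  \<open>i = 0\<close> is the base move 1.\<close>

lemma mem_moves_iff: "15 * i + 1 \<in> moves n k \<longleftrightarrow> i = 0 \<or> n < i"
proof -
  have "15 * i + 1 \<noteq> 15 * j + 3" "15 * i + 1 \<noteq> 15 * j - 3" for j
    by presburger+
  then show ?thesis
    unfolding moves_def base_moves_def by auto
qed

lemma infinite_moves: "infinite (moves n k)"
proof -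
  have "inj (\<lambda>i. 15 * (n + 1 + i) + 1)"
    by (auto simp: inj_def)
  then have "infinite (range (\<lambda>i. 15 * (n + 1 + i) + 1))"
    by (simp add: finite_image_iff)
  moreover have "range (\<lambda>i. 15 * (n + 1 + i) + 1) \<subseteq> moves n k"
    using mem_moves_iff by (simp only: image_subset_iff) simp
  ultimately show ?thesis
    using infinite_super by blast
qed

lemma inj_moves: "inj (\<lambda>n. moves n k)"
proof (rule linorder_injI)
  fix n m :: nat assume "n < m"
  then have "15 * m + 1 \<in> moves n k" "15 * m + 1 \<notin> moves m k"
    unfolding mem_moves_iff by simp_all
  then show "moves n k \<noteq> moves m k"
    by blast
qed

lemma infinite_Collect_moves:
  assumes "\<And>n. P (moves n k)"
  shows "infinite {S. subtraction_set S \<and> infinite S \<and> P S}"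
proof (rule infinite_super)
  show "range (\<lambda>n. moves n k) \<subseteq> {S. subtraction_set S \<and> infinite S \<and> P S}"
    using assms subtraction_set_moves infinite_moves by blast
  show "infinite (range (\<lambda>n. moves n k))"
    using inj_moves by (simp add: finite_image_iff)
qed

theorem corollary4p1:
  shows "(\<forall>k::nat. 1 \<le> k \<longrightarrow>
           infinite {S :: nat set. subtraction_set S \<and> infinite S \<and>
             eventually_periodic (outcome_of S) \<and> eventually_periodic (sg_value S) \<and>
             least_period (sg_value S) = k * least_period (outcome_of S)}) \<and>
         infinite {S :: nat set. subtraction_set S \<and> infinite S \<and>
           eventually_periodic (outcome_of S) \<and> \<not> eventually_periodic (sg_value S)}"
proof (intro conjI allI impI)
  have outcome: "eventually_periodic (outcome_of (moves n k))" for n k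
    unfolding eventually_periodic_def eventual_period_outcome_moves by (rule exI[of _ 15]) simp
  {
    fix k :: nat assume k: "1 \<le> k"
    show "infinite {S :: nat set. subtraction_set S \<and> infinite S \<and>
             eventually_periodic (outcome_of S) \<and> eventually_periodic (sg_value S) \<and>
             least_period (sg_value S) = k * least_period (outcome_of S)}"
    proof (intro infinite_Collect_moves[of _ k] conjI outcome)
      fix n
      show "eventually_periodic (sg_value (moves n k))"
        unfolding eventually_periodic_def eventual_period_sg_moves
        using k by (intro exI[of _ "k * 15"]) simp
      have "least_period (outcome_of (moves n k)) = 15"
        by (rule least_period_eqI[OF eventual_period_outcome_moves]) simp
      moreover have "least_period (sg_value (moves n k)) = k * 15"
        by (rule least_period_eqI[OF eventual_period_sg_moves]) (use k in simp)
      ultimately show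
        "least_period (sg_value (moves n k)) = k * least_period (outcome_of (moves n k))"
        by simp
    qed
  }
  show "infinite {S :: nat set. subtraction_set S \<and> infinite S \<and>
           eventually_periodic (outcome_of S) \<and> \<not> eventually_periodic (sg_value S)}"
    \<comment> \<open>With \<open>k = 0\<close>, a period \<open>t\<close> would have to be a
      multiple of 0, against \<open>1 \<le> t\<close>.\<close>
    by (intro infinite_Collect_moves[of _ 0] conjI outcome)
      (auto simp: eventually_periodic_def eventual_period_sg_moves)
qed

end
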